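(* Let $1\le m\le n$. Then, as an identity in the variables $x,y$, $$\sum_{F\in \mathcal F(m,n)} x^{\deg(0)}y^{\deg(p)}=(n-m+1)xy\Big[(m-1)\big((n-m+1)x+y+m-1\big)^{m-2}+\big(xy+(n-m)x+1\big)\big(xy+(n-m)x+m\big)^{m-2}\Big].$$
   Context: $\mathcal F(m,n)$ is the set of rooted forests with $n+1$ vertices and $m$ edges consisting of $n-m+1$ trees, whose roots are $n-m+1$ specified vertices labeled $01,02,\dots,0(n-m+1)$ and whose non-root vertices are labeled $1,\dots,m$. The degree of a vertex means its number of children. For $F\in\mathcal F(m,n)$, $\deg(0)$ is the sum of the degrees of all the roots $01,\dots,0(n-m+1)$, and $\deg(p)$ is the degree (number of children) of the parent $p$ of the vertex labeled $1$ (where $p$ may be a root). For $m=1$ (exponent $-1$) the right-hand side is read as a rational function. *)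

theory Defs
  imports "HOL-Computational_Algebra.Computational_Algebra"
begin

text \<open>
  The root vertex with label \<open>0i\<close> is \<open>Root i\<close>; the non-root vertex with label \<open>j\<close> is \<open>Nonroot j\<close>.
\<close>

datatype vertex = Root nat | Nonroot nat

text \<open>
  A rooted forest is given by its set of edges, each written as \<open>(parent, child)\<close>, i.e. directed
  away from the root of its tree. The tree with root \<open>r\<close> has the vertex set \<open>E\<^sup>* `` {r}\<close>; lemma
  \<open>rooted_forest_unique_root\<close> below shows that these trees partition the vertices.
\<close>

definition rooted_forest :: "'v set \<Rightarrow> 'v set \<Rightarrow> ('v \<times> 'v) set \<Rightarrow> bool" where
  "rooted_forest V R E \<longleftrightarrow>
     R \<subseteq> V \<and> E \<subseteq> V \<times> V \<and> acyclic E \<and>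
     (\<forall>r\<in>R. \<nexists>u. (u, r) \<in> E) \<and>
     (\<forall>v\<in>V - R. \<exists>!u. (u, v) \<in> E)"

definition children :: "('v \<times> 'v) set \<Rightarrow> 'v \<Rightarrow> 'v set" where
  "children E v = {w. (v, w) \<in> E}"

definition vdegree :: "('v \<times> 'v) set \<Rightarrow> 'v \<Rightarrow> nat" where
  "vdegree E v = card (children E v)"

definition parent :: "('v \<times> 'v) set \<Rightarrow> 'v \<Rightarrow> 'v" where
  "parent E v = (THE u. (u, v) \<in> E)"

definition roots :: "nat \<Rightarrow> nat \<Rightarrow> vertex set" where
  "roots m n = Root ` {1..n - m + 1}"

definition nonroots :: "nat \<Rightarrow> vertex set" where
  "nonroots m = Nonroot ` {1..m}"

text \<open>
  The \<open>n - m + 1\<close> roots and \<open>m\<close> non-roots give \<open>n + 1\<close> vertices, and there are automatically \<open>m\<close>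
  edges, one into each non-root (lemma \<open>card_edges_forests\<close>).
\<close>

definition forests :: "nat \<Rightarrow> nat \<Rightarrow> (vertex \<times> vertex) set set" where
  "forests m n = {E. rooted_forest (roots m n \<union> nonroots m) (roots m n) E}"

definition deg_roots :: "nat \<Rightarrow> nat \<Rightarrow> (vertex \<times> vertex) set \<Rightarrow> nat" where
  "deg_roots m n E = (\<Sum>r\<in>roots m n. vdegree E r)"

definition deg_parent1 :: "(vertex \<times> vertex) set \<Rightarrow> nat" where
  "deg_parent1 E = vdegree E (parent E (Nonroot 1))"

text \<open>The two indeterminates of the field \<open>\<rat>(x, y)\<close>, the fraction field of \<open>\<rat>[x][y]\<close>.\<close>

definition X :: "rat poly poly fract" where
  "X = to_fract [:[:0, 1:]:]"

definition Y :: "rat poly poly fract" where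
  "Y = to_fract [:0, 1:]"

lemma rooted_forest_unique_root:
  assumes F: "rooted_forest V R E" and "finite V" and "v \<in> V"
  shows "\<exists>!r. r \<in> R \<and> (r, v) \<in> E\<^sup>*"
proof -
  have EV: "E \<subseteq> V \<times> V" and R: "\<And>r u. r \<in> R \<Longrightarrow> (u, r) \<notin> E"
    and ex1: "\<And>v. v \<in> V - R \<Longrightarrow> \<exists>!u. (u, v) \<in> E"
    using F unfolding rooted_forest_def by auto
  have "finite E"
    using EV \<open>finite V\<close> by (meson finite_SigmaI finite_subset)
  then have "wf E"
    using F finite_acyclic_wf unfolding rooted_forest_def by blast
  then show ?thesis
    using \<open>v \<in> V\<close>
  proof (induction v rule: wf_induct_rule)
    case (less v)
    show ?case
    proof (cases "v \<in> R")
      case True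
      then show ?thesis
        using R by (metis rtrancl.cases rtrancl.rtrancl_refl)
    next
      case False
      then obtain u where u: "(u, v) \<in> E" "\<And>u'. (u', v) \<in> E \<Longrightarrow> u' = u"
        using ex1 less.prems by blast
      then have "(r, v) \<in> E\<^sup>* \<longleftrightarrow> (r, u) \<in> E\<^sup>*" if "r \<in> R" for r
        using False that by (metis rtrancl.cases rtrancl.rtrancl_into_rtrancl)
      moreover have "\<exists>!r. r \<in> R \<and> (r, u) \<in> E\<^sup>*"
        using less.IH u(1) EV by blast
      ultimately show ?thesis
        by metis
    qed
  qed
qed

lemma card_vertices:
  assumes "m \<le> n"
  shows "card (roots m n \<union> nonroots m) = n + 1"
proof -
  have "card (roots m n \<union> nonroots m) = card (roots m n) + card (nonroots m)"
    by (rule card_Un_disjoint) (auto simp: roots_def nonroots_def)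
  then show ?thesis
    using assms by (simp add: roots_def nonroots_def card_image inj_on_def)
qed

lemma finite_forests: "finite (forests m n)"
proof (rule finite_subset)
  let ?V = "roots m n \<union> nonroots m"
  show "forests m n \<subseteq> Pow (?V \<times> ?V)"
    by (auto simp: forests_def rooted_forest_def)
  show "finite (Pow (?V \<times> ?V))"
    by (simp add: roots_def nonroots_def)
qed

lemma card_edges_forests:
  assumes "E \<in> forests m n"
  shows "card E = m"
proof -
  have F: "rooted_forest (roots m n \<union> nonroots m) (roots m n) E"
    using assms by (simp add: forests_def)
  have disj: "roots m n \<inter> nonroots m = {}"
    by (auto simp: roots_def nonroots_def)
  then have ex1: "\<exists>!u. (u, v) \<in> E" if "v \<in> nonroots m" for v
    using F that unfolding rooted_forest_def by blast
  have heads: "snd ` E = nonroots m"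
  proof
    show "snd ` E \<subseteq> nonroots m"
      using F unfolding rooted_forest_def by auto
    show "nonroots m \<subseteq> snd ` E"
      using ex1 by (force simp: image_iff)
  qed
  then have "inj_on snd E"
    using ex1 by (intro inj_onI) (metis image_eqI prod.collapse)
  then have "card E = card (snd ` E)"
    by (simp add: card_image)
  then show ?thesis
    by (simp add: heads nonroots_def card_image inj_on_def)
qed

end

theory Submission
  imports Defs
begin

text \<open>
  The idea is to contract the edge from \<open>p\<close> to the vertex labelled 1.

  Give every vertex \<open>v\<close> a weight \<open>w v\<close>, and let the weight of a forest be the product of
  \<open>w v ^ deg v\<close>, i.e. the product over all edges of the weight of the parent. Consider the forests
  in which a given non-root \<open>c\<close> is a child of a given vertex \<open>p\<close>. Contracting that edge merges \<open>c\<close>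
  into \<open>p\<close>, and the original forest is recovered by deciding, for each child of the merged vertex,
  whether it hung from \<open>p\<close> or from \<open>c\<close>. So these forests contribute \<open>w p\<close> times the weighted sum
  over all forests without \<open>c\<close>, where \<open>p\<close> now carries the weight \<open>w p + w c\<close>
  (\<open>sum_parent_maps_contract\<close>).

  Summing over \<open>p\<close> and inducting on the number of non-roots gives the weighted Cayley formula
  \<open>r * W ^ (k - 1)\<close> for forests with \<open>k > 0\<close> non-roots, total root weight \<open>r\<close> and total weight \<open>W\<close>
  (\<open>weighted_forest_enumerator\<close>).

  For the theorem, split the sum by the parent \<open>p\<close> of the vertex 1. Once \<open>p\<close> is fixed, the statistic
  is of the form above: roots weigh \<open>x\<close>, non-roots 1, and the weight of \<open>p\<close> is multiplied by \<open>y\<close>.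
  Contract the edge from \<open>p\<close> to 1 and apply the weighted formula to the remaining \<open>m - 1\<close> non-roots.
  Each of the \<open>n - m + 1\<close> roots \<open>p\<close> has weight \<open>x y\<close>, which becomes \<open>x y + 1\<close> after contraction,
  and contributes \<open>x y (x y + (n - m) x + 1) (x y + (n - m) x + m) ^ (m - 2)\<close>. Each of the \<open>m - 1\<close>
  non-roots \<open>p\<close> other than 1 has weight \<open>y\<close>, leaves the root weights unchanged, and contributes
  \<open>y (n - m + 1) x ((n - m + 1) x + y + m - 1) ^ (m - 2)\<close>. If \<open>m = 1\<close>, nothing is left after
  contraction and each root contributes \<open>x y\<close>; the factor with exponent \<open>-1\<close> then cancels, because
  it is a nonzero element of the field.
\<close>

section \<open>Forests as acyclic parent maps\<close>

text \<open>
  A forest is determined by the map from its non-roots to their parents. Acyclicity is encoded by a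
  rank function that increases along every edge: rank functions are easy to transport along a
  contraction, whereas cycles are not.
\<close>

definition parent_maps :: "'v set \<Rightarrow> 'v set \<Rightarrow> ('v \<Rightarrow> 'v) set" where
  "parent_maps R N = {f \<in> N \<rightarrow>\<^sub>E R \<union> N. \<exists>h :: 'v \<Rightarrow> nat. \<forall>v\<in>N. h (f v) < h v}"

lemma finite_parent_maps:
  assumes "finite R" "finite N"
  shows "finite (parent_maps R N)"
  using assms by (auto simp: parent_maps_def intro!: finite_PiE)

lemma parent_maps_empty: "parent_maps R {} = {\<lambda>_. undefined}"
  by (auto simp: parent_maps_def)

section \<open>Contracting an edge\<close>

text \<open>
  Here \<open>g\<close> arises from \<open>F\<close> by contracting the edge from \<open>p\<close> to \<open>c\<close>. A rank function for \<open>F\<close> also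
  works for \<open>g\<close>, since \<open>p\<close> ranks below \<open>c\<close>. Conversely, doubling a rank function for \<open>g\<close> leaves
  room to insert \<open>c\<close> directly above \<open>p\<close> and below all other children of \<open>p\<close>.
\<close>

lemma ranked_contract_iff:
  fixes F g :: "'v \<Rightarrow> 'v"
  assumes "c \<in> N" "p \<noteq> c" "F c = p"
    and g: "\<And>v. v \<in> N - {c} \<Longrightarrow> g v = (if F v = c then p else F v)"
  shows "(\<exists>h :: 'v \<Rightarrow> nat. \<forall>v\<in>N. h (F v) < h v) \<longleftrightarrow>
         (\<exists>h :: 'v \<Rightarrow> nat. \<forall>v\<in>N - {c}. h (g v) < h v)"
proof
  assume "\<exists>h :: 'v \<Rightarrow> nat. \<forall>v\<in>N. h (F v) < h v"
  then obtain h :: "'v \<Rightarrow> nat" where h: "\<And>v. v \<in> N \<Longrightarrow> h (F v) < h v"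
    by blast
  have "h p < h c"
    using h[of c] assms by simp
  then have "h (g v) < h v" if "v \<in> N - {c}" for v
    using h[of v] g[OF that] that by (auto split: if_splits)
  then show "\<exists>h :: 'v \<Rightarrow> nat. \<forall>v\<in>N - {c}. h (g v) < h v"
    by blast
next
  assume "\<exists>h :: 'v \<Rightarrow> nat. \<forall>v\<in>N - {c}. h (g v) < h v"
  then obtain h :: "'v \<Rightarrow> nat" where h: "\<And>v. v \<in> N - {c} \<Longrightarrow> h (g v) < h v"
    by blast
  define h' where "h' = (\<lambda>v. 2 * h v)(c := 2 * h p + 1)"
  have "h' (F v) < h' v" if "v \<in> N" for v
  proof (cases "v = c")
    case True
    then show ?thesis
      using assms by (simp add: h'_def)
  next
    case False
    then show ?thesis
      using h[of v] g[of v] that by (auto simp: h'_def split: if_splits)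
  qed
  then show "\<exists>h :: 'v \<Rightarrow> nat. \<forall>v\<in>N. h (F v) < h v"
    by blast
qed

text \<open>
  The product on the right expands by distributivity: every child of \<open>p\<close> in \<open>g\<close> chooses the
  summand \<open>w p\<close> or \<open>w c\<close>, i.e. whether it is attached to \<open>p\<close> or to \<open>c\<close> before contraction. The
  pairs of a contracted forest and such choices correspond to the forests on the left.
\<close>

lemma sum_parent_maps_contract:
  fixes w :: "'v \<Rightarrow> 'a :: comm_semiring_1"
  assumes fin: "finite R" "finite N" and "c \<in> N" "c \<notin> R" and p: "p \<in> R \<union> N - {c}"
  shows "(\<Sum>f | f \<in> parent_maps R N \<and> f c = p. \<Prod>v\<in>N. w (f v)) =
         w p * (\<Sum>g\<in>parent_maps R (N - {c}). \<Prod>v\<in>N - {c}. (w(p := w p + w c)) (g v))"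
proof -
  define M where "M = N - {c}"
  have M: "finite M" "c \<notin> M" "N = insert c M"
    using fin \<open>c \<in> N\<close> by (auto simp: M_def)
  have pc: "p \<noteq> c" "p \<in> R \<union> M"
    using p by (auto simp: M_def)
  \<comment> \<open>the possible parents of \<open>v\<close> before contraction, if its parent after contraction is \<open>g v\<close>\<close>
  define B where "B = (\<lambda>(g :: 'v \<Rightarrow> 'v) v. if g v = p then {p, c} else {g v})"
  have expand: "(\<Prod>v\<in>M. (w(p := w p + w c)) (g v)) = (\<Sum>f\<in>PiE M (B g). \<Prod>v\<in>M. w (f v))" for g
  proof -
    have "(\<Prod>v\<in>M. (w(p := w p + w c)) (g v)) = (\<Prod>v\<in>M. \<Sum>u\<in>B g v. w u)"
      using pc by (intro prod.cong) (auto simp: B_def)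
    also have "\<dots> = (\<Sum>f\<in>PiE M (B g). \<Prod>v\<in>M. w (f v))"
      using M by (intro prod_sum_PiE) (auto simp: B_def)
    finally show ?thesis .
  qed
  let ?S = "SIGMA g : parent_maps R M. PiE M (B g)"
  let ?contract = "\<lambda>F. \<lambda>v\<in>M. if F v = c then p else F v"
  have "(\<Sum>f | f \<in> parent_maps R N \<and> f c = p. \<Prod>v\<in>N. w (f v)) =
        (\<Sum>(g, f)\<in>?S. w p * (\<Prod>v\<in>M. w (f v)))"
  proof (rule sum.reindex_bij_witness[where i = "\<lambda>(g, f). f(c := p)"
        and j = "\<lambda>F. (?contract F, restrict F M)"])
    fix F assume "F \<in> {f. f \<in> parent_maps R N \<and> f c = p}"
    then have F: "F \<in> N \<rightarrow>\<^sub>E R \<union> N" "F c = p" "\<exists>h :: 'v \<Rightarrow> nat. \<forall>v\<in>N. h (F v) < h v"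
      by (auto simp: parent_maps_def)
    show "(case (?contract F, restrict F M) of (g, f) \<Rightarrow> f(c := p)) = F"
      using F M by (auto simp: fun_eq_iff restrict_def PiE_def extensional_def)
    have "\<exists>h :: 'v \<Rightarrow> nat. \<forall>v\<in>M. h (?contract F v) < h v"
      using ranked_contract_iff[of c N p F "?contract F"] F(2,3) \<open>c \<in> N\<close> pc M_def by simp
    moreover have "?contract F \<in> M \<rightarrow>\<^sub>E R \<union> M"
      using F pc M by (auto simp: PiE_iff)
    ultimately have "?contract F \<in> parent_maps R M"
      by (simp add: parent_maps_def)
    moreover have "restrict F M \<in> PiE M (B (?contract F))"
      using pc by (auto simp: B_def)
    ultimately show "(?contract F, restrict F M) \<in> ?S"
      by simp
    show "(case (?contract F, restrict F M) of (g, f) \<Rightarrow> w p * (\<Prod>v\<in>M. w (f v))) = (\<Prod>v\<in>N. w (F v))"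
      using F M by simp
  next
    fix gf assume "gf \<in> ?S"
    then obtain g f where gf: "gf = (g, f)" "g \<in> M \<rightarrow>\<^sub>E R \<union> M"
      "\<exists>h :: 'v \<Rightarrow> nat. \<forall>v\<in>M. h (g v) < h v" "f \<in> PiE M (B g)"
      by (auto simp: parent_maps_def)
    have fB: "f v \<in> B g v" if "v \<in> M" for v
      using gf(4) that by (auto simp: PiE_iff)
    have gM: "g v \<in> R \<union> M" if "v \<in> M" for v
      using gf(2) that by (auto simp: PiE_iff)
    have ncR: "c \<notin> R \<union> M"
      using M \<open>c \<notin> R\<close> by blast
    have g_eq: "g v = (if (f(c := p)) v = c then p else (f(c := p)) v)" if "v \<in> N - {c}" for v
      using fB[of v] gM[of v] that ncR M_def by (auto simp: B_def split: if_splits)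
    have "f(c := p) \<in> N \<rightarrow>\<^sub>E R \<union> N"
    proof (rule PiE_I)
      fix v assume "v \<in> N"
      show "(f(c := p)) v \<in> R \<union> N"
      proof (cases "v = c")
        case True
        then show ?thesis using p by simp
      next
        case False
        then have "v \<in> M" using \<open>v \<in> N\<close> M_def by simp
        then show ?thesis
          using fB[of v] gM[of v] False p \<open>c \<in> N\<close> by (auto simp: B_def M split: if_splits)
      qed
    next
      fix v assume "v \<notin> N"
      then show "(f(c := p)) v = undefined"
        using gf(4) M by (auto simp: PiE_def extensional_def)
    qed
    moreover have "\<exists>h :: 'v \<Rightarrow> nat. \<forall>v\<in>N. h ((f(c := p)) v) < h v"
      using ranked_contract_iff[of c N p "f(c := p)" g] g_eq gf(3) \<open>c \<in> N\<close> pc M_def by simp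
    ultimately show "(case gf of (g, f) \<Rightarrow> f(c := p)) \<in> {f. f \<in> parent_maps R N \<and> f c = p}"
      by (simp add: parent_maps_def gf)
    have "?contract (f(c := p)) = g"
    proof
      fix v
      show "?contract (f(c := p)) v = g v"
        using g_eq[of v] gf(2) M_def by (cases "v \<in> M") (auto simp: PiE_def extensional_def)
    qed
    moreover have "restrict (f(c := p)) M = f"
      using gf(4) M by (auto simp: fun_eq_iff restrict_def PiE_def extensional_def)
    ultimately show "(?contract (case gf of (g, f) \<Rightarrow> f(c := p)),
        restrict (case gf of (g, f) \<Rightarrow> f(c := p)) M) = gf"
      by (simp only: gf(1) prod.case)
  qed
  also have "\<dots> = (\<Sum>g\<in>parent_maps R M. \<Sum>f\<in>PiE M (B g). w p * (\<Prod>v\<in>M. w (f v)))"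
    using M fin by (intro sum.Sigma[symmetric] ballI finite_parent_maps finite_PiE) (auto simp: B_def)
  also have "\<dots> = w p * (\<Sum>g\<in>parent_maps R M. \<Prod>v\<in>M. (w(p := w p + w c)) (g v))"
    by (simp only: expand sum_distrib_left)
  finally show ?thesis
    by (simp only: M_def)
qed

lemma sum_parent_maps_by_parent:
  fixes t :: "('v \<Rightarrow> 'v) \<Rightarrow> 'a :: comm_monoid_add"
  assumes "finite R" "finite N" "c \<in> N"
  shows "(\<Sum>f\<in>parent_maps R N. t f) =
         (\<Sum>p\<in>R \<union> N - {c}. \<Sum>f | f \<in> parent_maps R N \<and> f c = p. t f)"
proof (rule sum.group[symmetric])
  show "finite (parent_maps R N)" "finite (R \<union> N - {c})"
    using assms by (auto intro: finite_parent_maps)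
  show "(\<lambda>f. f c) ` parent_maps R N \<subseteq> R \<union> N - {c}"
  proof (rule image_subsetI)
    fix f assume f: "f \<in> parent_maps R N"
    then obtain h :: "'v \<Rightarrow> nat" where "h (f c) < h c"
      using \<open>c \<in> N\<close> unfolding parent_maps_def by blast
    then show "f c \<in> R \<union> N - {c}"
      using f \<open>c \<in> N\<close> by (auto simp: parent_maps_def PiE_iff)
  qed
qed

section \<open>The weighted Cayley formula for forests\<close>

lemma sum_fun_upd_add:
  fixes w :: "'v \<Rightarrow> 'a :: comm_semiring_1"
  assumes "finite A" "p \<in> A"
  shows "sum (w(p := w p + d)) A = sum w A + d"
proof -
  have "sum (w(p := w p + d)) A = (w p + d) + sum w (A - {p})"
    using assms by (simp add: sum.remove[of A p])
  then show ?thesis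
    using assms by (simp add: sum.remove[of A p w] add_ac)
qed

text \<open>
  Contract the edge above an arbitrary non-root \<open>c\<close>. Since \<open>w c\<close> moves to the parent \<open>p\<close>, the total
  weight \<open>W\<close> is preserved, and the root weight \<open>r\<close> grows by \<open>w c\<close> exactly if \<open>p\<close> is a root. With \<open>s\<close>
  the weight of the non-roots other than \<open>c\<close>, if there are any, the cofactor of \<open>W ^ (card N - 2)\<close> is
  \<open>r * (r + w c) + s * r = r * W\<close>.
\<close>

theorem weighted_forest_enumerator:
  fixes w :: "'v \<Rightarrow> 'a :: comm_semiring_1"
  assumes "finite R" "finite N" "N \<noteq> {}" "R \<inter> N = {}"
  shows "(\<Sum>f\<in>parent_maps R N. \<Prod>v\<in>N. w (f v)) = sum w R * sum w (R \<union> N) ^ (card N - 1)"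
  using assms(2-4)
proof (induction "card N" arbitrary: N w rule: less_induct)
  case (less N w)
  obtain c where c: "c \<in> N"
    using less.prems by blast
  define M where "M = N - {c}"
  have M: "finite M" "c \<notin> M" "N = insert c M" "R \<inter> M = {}" "c \<notin> R"
    using less.prems c by (auto simp: M_def)
  have W: "sum w (R \<union> N) = sum w R + sum w M + w c"
    using M assms(1) by (simp add: sum.union_disjoint add_ac)
  let ?W = "sum w (R \<union> N)"
  let ?r = "sum w R"
  have split: "(\<Sum>f\<in>parent_maps R N. \<Prod>v\<in>N. w (f v)) =
      (\<Sum>p\<in>R \<union> M. w p * (\<Sum>g\<in>parent_maps R M. \<Prod>v\<in>M. (w(p := w p + w c)) (g v)))"
  proof -
    have RM: "R \<union> N - {c} = R \<union> M"
      using M by blast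
    show ?thesis
      unfolding sum_parent_maps_by_parent[OF assms(1) less.prems(1) c] RM
      by (intro sum.cong refl) (simp add: M_def sum_parent_maps_contract[OF assms(1) less.prems(1) c M(5)] RM[unfolded M_def])
  qed
  show ?case
  proof (cases "M = {}")
    case True
    then show ?thesis
      unfolding split using M by (simp add: parent_maps_empty)
  next
    case False
    have card: "card N - 1 = Suc (card M - 1)" "card M < card N"
      using M False by (auto simp: card_gt_0_iff)
    have IH: "(\<Sum>g\<in>parent_maps R M. \<Prod>v\<in>M. w' (g v)) = sum w' R * sum w' (R \<union> M) ^ (card M - 1)"
      for w' :: "'v \<Rightarrow> 'a"
      using less.hyps[OF card(2) M(1) False M(4)] .
    have tot: "sum (w(p := w p + w c)) (R \<union> M) = ?W" if "p \<in> R \<union> M" for p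
      using sum_fun_upd_add[OF _ that, of w "w c"] M assms(1) W by (simp add: sum.union_disjoint)
    have root: "sum (w(p := w p + w c)) R = ?r + w c" if "p \<in> R" for p
      using sum_fun_upd_add[OF assms(1) that] .
    have inner: "sum (w(p := w p + w c)) R = ?r" if "p \<in> M" for p
      using that M by (intro sum.cong) auto
    have "(\<Sum>f\<in>parent_maps R N. \<Prod>v\<in>N. w (f v)) =
        (\<Sum>p\<in>R \<union> M. w p * (sum (w(p := w p + w c)) R * ?W ^ (card M - 1)))"
      unfolding split IH by (intro sum.cong refl) (simp only: tot)
    also have "\<dots> = (\<Sum>p\<in>R. w p * ((?r + w c) * ?W ^ (card M - 1))) + (\<Sum>p\<in>M. w p * (?r * ?W ^ (card M - 1)))"
      unfolding sum.union_disjoint[OF assms(1) M(1,4)]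
      by (intro arg_cong2[where f = plus] sum.cong refl) (simp_all only: root inner)
    also have "\<dots> = ?r * ((?r + w c) * ?W ^ (card M - 1)) + sum w M * (?r * ?W ^ (card M - 1))"
      by (simp add: sum_distrib_right)
    also have "\<dots> = ?r * (?W * ?W ^ (card M - 1))"
      by (simp add: W algebra_simps)
    finally show ?thesis
      by (simp only: card(1) power_Suc)
  qed
qed

section \<open>Parent maps and edge sets\<close>

definition edges_of :: "'v set \<Rightarrow> ('v \<Rightarrow> 'v) \<Rightarrow> ('v \<times> 'v) set" where
  "edges_of N f = (\<lambda>v. (f v, v)) ` N"

lemma mem_edges_of [simp]: "(u, v) \<in> edges_of N f \<longleftrightarrow> v \<in> N \<and> u = f v"
  by (auto simp: edges_of_def)

text \<open>The number of proper ancestors of a vertex serves as its rank.\<close>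

lemma acyclic_edges_of_iff:
  fixes f :: "'v \<Rightarrow> 'v"
  assumes "finite N"
  shows "acyclic (edges_of N f) \<longleftrightarrow> (\<exists>h :: 'v \<Rightarrow> nat. \<forall>v\<in>N. h (f v) < h v)"
proof
  assume acyc: "acyclic (edges_of N f)"
  let ?E = "edges_of N f"
  let ?A = "\<lambda>v. {u. (u, v) \<in> ?E\<^sup>+}"
  have fin: "finite (?A v)" for v
  proof (rule finite_subset)
    show "?A v \<subseteq> Domain ?E"
      by (auto simp del: mem_edges_of dest: tranclD)
    show "finite (Domain ?E)"
      using assms by (simp add: edges_of_def finite_Domain)
  qed
  have "card (?A (f v)) < card (?A v)" if "v \<in> N" for v
  proof (rule psubset_card_mono[OF fin])
    have "(f v, v) \<in> ?E"
      using that by simp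
    then have "?A (f v) \<subseteq> ?A v" "f v \<in> ?A v"
      by (auto intro: trancl_into_trancl)
    moreover have "f v \<notin> ?A (f v)"
      using acyc by (auto simp: acyclic_def)
    ultimately show "?A (f v) \<subset> ?A v"
      by blast
  qed
  then show "\<exists>h :: 'v \<Rightarrow> nat. \<forall>v\<in>N. h (f v) < h v"
    by (intro exI[of _ "\<lambda>v. card (?A v)"]) blast
next
  assume "\<exists>h :: 'v \<Rightarrow> nat. \<forall>v\<in>N. h (f v) < h v"
  then obtain h :: "'v \<Rightarrow> nat" where "\<And>v. v \<in> N \<Longrightarrow> h (f v) < h v"
    by blast
  then have "edges_of N f \<subseteq> measure h"
    by (auto simp: edges_of_def)
  then show "acyclic (edges_of N f)"
    by (rule wf_acyclic[OF wf_subset[OF wf_measure]])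
qed

lemma bij_betw_edges_of:
  assumes "finite N" "R \<inter> N = {}"
  shows "bij_betw (edges_of N) (parent_maps R N) {E. rooted_forest (R \<union> N) R E}"
proof (rule bij_betw_imageI)
  show "inj_on (edges_of N) (parent_maps R N)"
  proof (rule inj_onI)
    fix f g assume fg: "f \<in> parent_maps R N" "g \<in> parent_maps R N" "edges_of N f = edges_of N g"
    show "f = g"
    proof (rule PiE_ext)
      show "f \<in> N \<rightarrow>\<^sub>E R \<union> N" "g \<in> N \<rightarrow>\<^sub>E R \<union> N"
        using fg by (auto simp: parent_maps_def)
      show "f v = g v" if "v \<in> N" for v
        using that fg(3) mem_edges_of[of "f v" v N] by blast
    qed
  qed
  show "edges_of N ` parent_maps R N = {E. rooted_forest (R \<union> N) R E}"
  proof (intro equalityI subsetI)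
    fix E assume "E \<in> edges_of N ` parent_maps R N"
    then obtain f where f: "E = edges_of N f" "f \<in> parent_maps R N"
      by blast
    then have "acyclic E"
      using acyclic_edges_of_iff[OF assms(1)] by (simp add: parent_maps_def)
    moreover have "f v \<in> R \<union> N" if "v \<in> N" for v
      using f(2) that by (auto simp: parent_maps_def PiE_iff)
    ultimately show "E \<in> {E. rooted_forest (R \<union> N) R E}"
      using assms(2) by (fastforce simp: rooted_forest_def f(1))
  next
    fix E assume "E \<in> {E. rooted_forest (R \<union> N) R E}"
    then have EV: "E \<subseteq> (R \<union> N) \<times> (R \<union> N)" and ac: "acyclic E" and R: "\<And>r u. r \<in> R \<Longrightarrow> (u, r) \<notin> E"
      and ex1: "\<And>v. v \<in> N \<Longrightarrow> \<exists>!u. (u, v) \<in> E"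
      using assms(2) unfolding rooted_forest_def by blast+
    let ?f = "restrict (parent E) N"
    have par: "(u, v) \<in> E \<longleftrightarrow> u = parent E v" if "v \<in> N" for u v
      using theI'[OF ex1[OF that]] ex1[OF that] unfolding parent_def by blast
    have E: "E = edges_of N ?f"
      using EV R par by (auto simp: edges_of_def image_iff)
    have "?f \<in> N \<rightarrow>\<^sub>E R \<union> N"
      using par EV by (auto simp: PiE_iff)
    moreover have "\<exists>h :: 'a \<Rightarrow> nat. \<forall>v\<in>N. h (?f v) < h v"
      using acyclic_edges_of_iff[OF assms(1), of ?f] ac E by simp
    ultimately have "?f \<in> parent_maps R N"
      unfolding parent_maps_def by blast
    then show "E \<in> edges_of N ` parent_maps R N"
      using E by blast
  qed
qed

section \<open>The joint distribution of the two degrees\<close>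

lemma vdegree_edges_of: "vdegree (edges_of N f) u = card {v \<in> N. f v = u}"
  by (simp add: vdegree_def children_def conj_commute eq_commute)

lemma parent_edges_of: "v \<in> N \<Longrightarrow> parent (edges_of N f) v = f v"
  by (simp add: parent_def)

lemma prod_ite_eq_power:
  assumes "finite N"
  shows "(\<Prod>v\<in>N. if P v then a else 1) = (a :: 'a :: comm_monoid_mult) ^ card {v \<in> N. P v}"
  using assms by (simp add: prod.If_cases Int_def)

lemma of_nat_fract_eq_to_fract: "of_nat k = to_fract (of_nat k)"
  by (induction k) simp_all

text \<open>This justifies cancelling the base of the power with exponent \<open>-1\<close> when \<open>m = 1\<close>.\<close>

lemma XY_linear_nonzero: "X * Y + of_nat k * X + 1 \<noteq> 0"
proof -
  have "X * Y + of_nat k * X + 1 = to_fract [:[:1, of_nat k:], [:0, 1:]:]"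
    by (simp add: X_def Y_def of_nat_fract_eq_to_fract of_nat_poly
        flip: to_fract_mult to_fract_add to_fract_1) (simp add: one_pCons)
  then show ?thesis
    by simp
qed

theorem theorem4p1:
  fixes m n :: nat
  assumes "1 \<le> m" and "m \<le> n"
  shows "(\<Sum>F\<in>forests m n. X ^ deg_roots m n F * Y ^ deg_parent1 F) =
    of_nat (n - m + 1) * X * Y *
      (of_nat (m - 1) * (of_nat (n - m + 1) * X + Y + of_nat (m - 1)) powi (int m - 2)
       + (X * Y + of_nat (n - m) * X + 1) * (X * Y + of_nat (n - m) * X + of_nat m) powi (int m - 2))"
proof -
  define R N c where "R = roots m n" and "N = nonroots m" and "c = Nonroot 1"
  define M where "M = N - {c}"
  have fin: "finite R" "finite N" "finite M" and disj: "R \<inter> N = {}" "R \<inter> M = {}" and c: "c \<in> N" "c \<notin> R"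
    using assms by (auto simp: R_def N_def M_def c_def roots_def nonroots_def)
  have cardR: "card R = n - m + 1" and cardN: "card N = m" and cardM: "card M = m - 1"
    using c by (auto simp: R_def N_def M_def roots_def nonroots_def card_image inj_on_def)
  \<comment> \<open>\<open>w p u\<close> is the weight of the vertex \<open>u\<close> when \<open>p\<close> is the parent of \<open>c\<close>\<close>
  define w where "w = (\<lambda>p u. (if u \<in> R then X else 1) * (if u = p then Y else 1))"
  have weight: "X ^ deg_roots m n (edges_of N f) * Y ^ deg_parent1 (edges_of N f) =
      (\<Prod>v\<in>N. w (f c) (f v))" for f
  proof -
    have "deg_roots m n (edges_of N f) = (\<Sum>r\<in>R. card {v \<in> N. f v = r})"
      by (simp add: deg_roots_def vdegree_edges_of R_def)
    also have "\<dots> = card (\<Union>r\<in>R. {v \<in> N. f v = r})"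
      using fin by (intro card_UN_disjoint[symmetric]) auto
    also have "(\<Union>r\<in>R. {v \<in> N. f v = r}) = {v \<in> N. f v \<in> R}"
      by blast
    finally have "deg_roots m n (edges_of N f) = card {v \<in> N. f v \<in> R}" .
    moreover have "deg_parent1 (edges_of N f) = card {v \<in> N. f v = f c}"
      using c by (simp add: deg_parent1_def vdegree_edges_of parent_edges_of c_def)
    ultimately show ?thesis
      using fin by (simp add: w_def prod.distrib prod_ite_eq_power)
  qed
  \<comment> \<open>the weighted sum over the forests that remain after contracting the edge from \<open>p\<close> to \<open>c\<close>\<close>
  define S where "S = (\<lambda>p. \<Sum>g\<in>parent_maps R M. \<Prod>v\<in>M. ((w p)(p := w p p + w p c)) (g v))"
  have RM: "R \<union> N - {c} = R \<union> M"
    using c by (auto simp: M_def)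
  have "(\<Sum>F\<in>forests m n. X ^ deg_roots m n F * Y ^ deg_parent1 F) =
      (\<Sum>f\<in>parent_maps R N. \<Prod>v\<in>N. w (f c) (f v))"
    using sum.reindex_bij_betw[OF bij_betw_edges_of[OF fin(2) disj(1)],
        of "\<lambda>F. X ^ deg_roots m n F * Y ^ deg_parent1 F"]
    unfolding weight by (simp add: forests_def R_def N_def)
  also have "\<dots> = (\<Sum>p\<in>R \<union> M. \<Sum>f | f \<in> parent_maps R N \<and> f c = p. \<Prod>v\<in>N. w p (f v))"
    unfolding sum_parent_maps_by_parent[OF fin(1,2) c(1)] RM by (intro sum.cong refl) auto
  also have "\<dots> = (\<Sum>p\<in>R \<union> M. w p p * S p)"
    unfolding S_def
    by (intro sum.cong refl) (simp add: M_def sum_parent_maps_contract[OF fin(1,2) c] RM[unfolded M_def])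
  also have "\<dots> = (\<Sum>p\<in>R. w p p * S p) + (\<Sum>p\<in>M. w p p * S p)"
    using fin disj by (intro sum.union_disjoint)
  finally have total: "(\<Sum>F\<in>forests m n. X ^ deg_roots m n F * Y ^ deg_parent1 F) =
      (\<Sum>p\<in>R. w p p * S p) + (\<Sum>p\<in>M. w p p * S p)" .
  have sumwR: "sum (w p) R = X * Y + of_nat (n - m) * X" if "p \<in> R" for p
  proof -
    have "sum (w p) R = w p p + (\<Sum>u\<in>R - {p}. X)"
      using fin that by (simp add: sum.remove[of R p] w_def)
    then show ?thesis
      using that fin cardR by (simp add: w_def)
  qed
  have sumwR': "sum (w p) R = of_nat (n - m + 1) * X" if "p \<in> M" for p
  proof -
    have "sum (w p) R = (\<Sum>u\<in>R. X)"
      using that disj by (intro sum.cong) (auto simp: w_def)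
    then show ?thesis
      using cardR by simp
  qed
  have sumwM: "sum (w p) M = of_nat (m - 1)" if "p \<in> R" for p
  proof -
    have "sum (w p) M = (\<Sum>u\<in>M. 1)"
      using that disj by (intro sum.cong) (auto simp: w_def)
    then show ?thesis
      using cardM by simp
  qed
  \<comment> \<open>The \<open>1\<close> is the weight of \<open>c\<close>; on the left it makes up for the term \<open>p\<close>, so that no \<open>m - 2\<close> occurs.\<close>
  have sumwM': "sum (w p) M + 1 = Y + of_nat (m - 1)" if "p \<in> M" for p
  proof -
    have "sum (w p) M = w p p + sum (w p) (M - {p})"
      using fin that by (intro sum.remove)
    also have "sum (w p) (M - {p}) = (\<Sum>u\<in>M - {p}. 1)"
      using disj by (intro sum.cong) (auto simp: w_def)
    finally have "sum (w p) M = w p p + of_nat (card (M - {p}))"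
      by simp
    moreover have "card M = Suc (card (M - {p}))"
      using fin that by (metis card.remove)
    moreover have "w p p = Y"
      using that disj by (auto simp: w_def)
    ultimately show ?thesis
      using cardM by (simp add: add_ac)
  qed
  have wc: "w p c = 1" if "p \<in> R \<union> M" for p
    using that c by (auto simp: w_def M_def)
  show ?thesis
  proof (cases "m = 1")
    case True
    then have "M = {}"
      using cardM fin by simp
    then have "(\<Sum>F\<in>forests m n. X ^ deg_roots m n F * Y ^ deg_parent1 F) = of_nat (n - m + 1) * (X * Y)"
      unfolding total S_def by (simp add: parent_maps_empty w_def cardR)
    then show ?thesis
      using True XY_linear_nonzero[of "n - 1"] by (simp add: power_int_minus)
  next
    case False
    then have "m \<ge> 2"
      using assms by simp
    then have exps: "int m - 2 = int (m - 2)" "card M - 1 = m - 2" and Mne: "M \<noteq> {}"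
      using cardM by auto
    have S: "S p = sum ((w p)(p := w p p + w p c)) R * (sum (w p) R + sum (w p) M + 1) ^ (m - 2)"
      if "p \<in> R \<union> M" for p
    proof -
      have "sum ((w p)(p := w p p + w p c)) (R \<union> M) = sum (w p) R + sum (w p) M + 1"
        using sum_fun_upd_add[OF _ that, of "w p" "w p c"] fin disj wc[OF that] by (simp add: sum.union_disjoint)
      then show ?thesis
        unfolding S_def weighted_forest_enumerator[OF fin(1,3) Mne disj(2)] exps(2) by simp
    qed
    have SR: "w p p * S p = X * Y * ((X * Y + of_nat (n - m) * X + 1) * (X * Y + of_nat (n - m) * X + of_nat m) ^ (m - 2))"
      if "p \<in> R" for p
    proof -
      have "of_nat (m - 1) + (1 :: rat poly poly fract) = of_nat m"
        using assms by (metis of_nat_1 of_nat_add le_add_diff_inverse2)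
      then show ?thesis
        using that S[of p] sum_fun_upd_add[OF fin(1) that, of "w p" "w p c"] wc[of p] sumwR[OF that] sumwM[OF that]
        by (simp add: add.assoc) (simp add: w_def)
    qed
    have SM: "w p p * S p = Y * (of_nat (n - m + 1) * X * (of_nat (n - m + 1) * X + Y + of_nat (m - 1)) ^ (m - 2))"
      if "p \<in> M" for p
    proof -
      have "sum ((w p)(p := w p p + w p c)) R = sum (w p) R"
        using that disj by (intro sum.cong) auto
      moreover have "w p p = Y"
        using that disj by (auto simp: w_def)
      ultimately show ?thesis
        using that S[of p] sumwR'[OF that] sumwM'[OF that] by (simp only: add.assoc UnI2)
    qed
    show ?thesis
      unfolding total exps(1) power_int_of_nat
      by (simp add: SR SM cardR cardM del: of_nat_diff of_nat_add) (simp add: algebra_simps del: of_nat_diff of_nat_add)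
  qed
qed

end
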